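(* For all $n\ge1$, the characteristic polynomial of the poset $\Pi_n^w$ of weighted partitions of $\{1,\dots,n\}$ is given by $$\chi_{\Pi_n^{w}}(x):=\sum_{\alpha \in \Pi_n^w}\mu_{\Pi_n^w}(\hat{0},\alpha)\,x^{n-1-\rho(\alpha)}=(x-n)^{n-1}.$$
   Context: Let $[n]=\{1,\dots,n\}$. A weighted partition of $[n]$ is a set $\{B_1^{v_1},\dots,B_t^{v_t}\}$ where $\{B_1,\dots,B_t\}$ is a partition of $[n]$ and $v_i\in\{0,1,\dots,|B_i|-1\}$ for all $i$. The poset $\Pi_n^w$ is the set of weighted partitions of $[n]$ ordered by: $\{A_1^{w_1},\dots,A_s^{w_s}\}\le\{B_1^{v_1},\dots,B_t^{v_t}\}$ iff (a) $\{A_1,\dots,A_s\}$ refines $\{B_1,\dots,B_t\}$, and (b) whenever $B_k=A_{i_1}\cup\cdots\cup A_{i_l}$, then $v_k-(w_{i_1}+\cdots+w_{i_l})\in\{0,1,\dots,l-1\}$. Its minimum element is $\hat 0=\{\{1\}^0,\dots,\{n\}^0\}$. The poset $\Pi_n^w$ is pure of length $n-1$; its rank function is $\rho(\alpha)=$ length of the longest chain of $[\hat 0,\alpha]$, which equals $n-|\alpha|$ where $|\alpha|$ is the number of blocks of $\alpha$. $\mu_{\Pi_n^w}$ denotes the Möbius function. *)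

theory Defs
  imports
    "HOL-Library.Disjoint_Sets"
    "HOL-Computational_Algebra.Polynomial"
begin

section \<open>Posets given by a relation\<close>

definition poset_interval :: "('a \<times> 'a) set \<Rightarrow> 'a \<Rightarrow> 'a \<Rightarrow> 'a set"
  where "poset_interval r x y = {z. (x, z) \<in> r \<and> (z, y) \<in> r}"

text \<open>
  The recursion needs \<open>r\<close> to be a partial order with finite intervals in order to terminate; away
  from such relations the value is junk. For the order of weighted partitions both conditions hold,
  see \<open>mobius_wpart\<close> below.
\<close>

function mobius :: "('a \<times> 'a) set \<Rightarrow> 'a \<Rightarrow> 'a \<Rightarrow> int" where
  "mobius r x y =
     (if x = y then 1
      else if (x, y) \<in> r \<and> Partial_order r \<and> finite (poset_interval r x y)
      then - (\<Sum>z\<in>poset_interval r x y - {y}. mobius r x z)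
      else 0)"
  by pat_completeness auto
termination
proof (relation "Wellfounded.measure (\<lambda>(r, x, y). card (poset_interval r x y))", goal_cases)
  case 1
  show ?case by simp
next
  case (2 r x y z)
  then have xy: "(x, y) \<in> r" and zy: "(z, y) \<in> r" and "z \<noteq> y"
    and po: "Partial_order r" and fin: "finite (poset_interval r x y)"
    by (auto simp: poset_interval_def)
  from po have "refl_on (Field r) r" "trans r" "antisym r"
    by (auto simp: partial_order_on_def preorder_on_def)
  then have "y \<notin> poset_interval r x z" "poset_interval r x z \<subseteq> poset_interval r x y"
    "y \<in> poset_interval r x y"
    using xy zy \<open>z \<noteq> y\<close>
    by (auto simp: poset_interval_def refl_on_def Field_def dest: antisymD transD)
  then have "poset_interval r x z \<subset> poset_interval r x y" by blast
  then show ?case using fin by (auto intro: psubset_card_mono)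
qed

declare mobius.simps [simp del]

text \<open>The length of a chain is one less than its number of elements.\<close>

definition poset_rank :: "('a \<times> 'a) set \<Rightarrow> 'a \<Rightarrow> 'a \<Rightarrow> nat"
  where "poset_rank r m x =
    Max {card C - 1 | C. C \<in> Chains r \<and> C \<noteq> {} \<and> C \<subseteq> poset_interval r m x}"


section \<open>Weighted partitions\<close>

text \<open>A weighted block \<open>B\<^sup>v\<close> is the pair \<open>(B, v)\<close>.\<close>

definition weighted_partitions :: "nat \<Rightarrow> (nat set \<times> nat) set set"
  where "weighted_partitions n =
    {\<alpha>. inj_on fst \<alpha> \<and> partition_on {1..n} (fst ` \<alpha>) \<and> (\<forall>(B, v)\<in>\<alpha>. v \<in> {0..card B - 1})}"

definition wpart_rel :: "nat \<Rightarrow> ((nat set \<times> nat) set \<times> (nat set \<times> nat) set) set"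
  where "wpart_rel n =
    {(\<alpha>, \<beta>). \<alpha> \<in> weighted_partitions n \<and> \<beta> \<in> weighted_partitions n \<and>
       refines {1..n} (fst ` \<alpha>) (fst ` \<beta>) \<and>
       (\<forall>(B, v)\<in>\<beta>. \<forall>S\<subseteq>\<alpha>. B = (\<Union>(A, w)\<in>S. A) \<longrightarrow>
          int v - (\<Sum>(A, w)\<in>S. int w) \<in> {0..int (card S) - 1})}"

definition wpart_bot :: "nat \<Rightarrow> (nat set \<times> nat) set"
  where "wpart_bot n = (\<lambda>i. ({i}, 0)) ` {1..n}"

definition wpart_charpoly :: "nat \<Rightarrow> int poly"
  where "wpart_charpoly n =
    (\<Sum>\<alpha>\<in>weighted_partitions n.
       monom (mobius (wpart_rel n) (wpart_bot n) \<alpha>)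
             (n - 1 - poset_rank (wpart_rel n) (wpart_bot n) \<alpha>))"


section \<open>Weighted partitions form a finite poset with least element\<close>

lemma finite_weighted_partitions: "finite (weighted_partitions n)"
proof (rule finite_subset)
  show "weighted_partitions n \<subseteq> Pow (Pow {1..n} \<times> {0..n})"
  proof (rule subsetI, rule PowI, rule subsetI)
    fix \<alpha> X assume \<alpha>: "\<alpha> \<in> weighted_partitions n" and X: "X \<in> \<alpha>"
    obtain B v where [simp]: "X = (B, v)" by (cases X)
    have B: "B \<subseteq> {1..n}" and "v \<le> card B - 1"
      using \<alpha> X by (force simp: weighted_partitions_def partition_on_def)+
    moreover have "card B \<le> n" using card_mono[OF _ B] by simp
    ultimately show "X \<in> Pow {1..n} \<times> {0..n}" by auto
  qed
qed auto

lemma wpart_finite: "\<alpha> \<in> weighted_partitions n \<Longrightarrow> finite \<alpha>"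
  unfolding weighted_partitions_def
  using finite_elements[of "{1..n}" "fst ` \<alpha>"] finite_imageD[of fst \<alpha>] by simp

lemma wpart_disjoint:
  assumes "\<alpha> \<in> weighted_partitions n" "X \<in> \<alpha>" "Y \<in> \<alpha>" "i \<in> fst X" "i \<in> fst Y"
  shows "X = Y"
proof -
  have "fst X = fst Y"
    using assms unfolding weighted_partitions_def partition_on_def disjoint_def by blast
  then show ?thesis using assms by (auto simp: weighted_partitions_def dest: inj_onD)
qed

lemma wpart_nonempty: "\<alpha> \<in> weighted_partitions n \<Longrightarrow> X \<in> \<alpha> \<Longrightarrow> fst X \<noteq> {}"
  by (auto simp: weighted_partitions_def partition_on_def)

lemma wpart_cover:
  assumes "\<alpha> \<in> weighted_partitions n" shows "(\<Union>X\<in>\<alpha>. fst X) = {1..n}"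
  using assms by (auto simp: weighted_partitions_def partition_on_def)

text \<open>The blocks whose union is a given block of a coarser partition are those contained in it.\<close>

lemma wpart_union_unique:
  assumes "\<alpha> \<in> weighted_partitions n" "S \<subseteq> \<alpha>" "B = (\<Union>X\<in>S. fst X)"
  shows "S = {X\<in>\<alpha>. fst X \<subseteq> B}"
proof
  show "S \<subseteq> {X\<in>\<alpha>. fst X \<subseteq> B}" using assms by auto
  show "{X\<in>\<alpha>. fst X \<subseteq> B} \<subseteq> S"
  proof clarify
    fix A w assume X: "(A, w) \<in> \<alpha>" "fst (A, w) \<subseteq> B"
    obtain i where i: "i \<in> A" using wpart_nonempty[OF assms(1) X(1)] by auto
    then obtain Y where "Y \<in> S" "i \<in> fst Y" using X assms(3) by auto
    then show "(A, w) \<in> S" using wpart_disjoint[OF assms(1) X(1), of Y i] assms(2) i by auto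
  qed
qed

lemma wpart_union_exists:
  assumes "refines {1..n} (fst ` \<alpha>) (fst ` \<beta>)" "Y \<in> \<beta>"
  shows "(\<Union>X\<in>{X\<in>\<alpha>. fst X \<subseteq> fst Y}. fst X) = fst Y"
proof -
  have "i \<in> (\<Union>X\<in>{X\<in>\<alpha>. fst X \<subseteq> fst Y}. fst X)" if i: "i \<in> fst Y" for i
  proof -
    have pa: "\<Union>(fst ` \<alpha>) = {1..n}" and pb: "\<Union>(fst ` \<beta>) = {1..n}" and d: "disjoint (fst ` \<beta>)"
      and r: "\<forall>X\<in>fst ` \<alpha>. \<exists>Y\<in>fst ` \<beta>. X \<subseteq> Y"
      using assms by (auto simp: refines_def partition_on_def)
    have "i \<in> {1..n}" using pb i assms(2) by auto
    then obtain X where X: "X \<in> \<alpha>" "i \<in> fst X" using pa by blast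
    then obtain Z where Z: "Z \<in> fst ` \<beta>" "fst X \<subseteq> Z" using r by blast
    have "Z = fst Y" using d Z i X assms(2) unfolding disjoint_def by blast
    then have "X \<in> {X\<in>\<alpha>. fst X \<subseteq> fst Y}" using X Z by simp
    then show ?thesis using X by blast
  qed
  then show ?thesis by blast
qed

lemma wpart_rel_iff:
  assumes "\<alpha> \<in> weighted_partitions n" "\<beta> \<in> weighted_partitions n"
  shows "(\<alpha>, \<beta>) \<in> wpart_rel n \<longleftrightarrow>
    refines {1..n} (fst ` \<alpha>) (fst ` \<beta>) \<and>
    (\<forall>Y\<in>\<beta>. let S = {X\<in>\<alpha>. fst X \<subseteq> fst Y} in
       int (snd Y) - (\<Sum>X\<in>S. int (snd X)) \<in> {0..int (card S) - 1})"
proof -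
  have "(\<forall>S\<subseteq>\<alpha>. fst Y = (\<Union>X\<in>S. fst X) \<longrightarrow>
          int (snd Y) - (\<Sum>X\<in>S. int (snd X)) \<in> {0..int (card S) - 1}) \<longleftrightarrow>
        (let S = {X\<in>\<alpha>. fst X \<subseteq> fst Y} in
          int (snd Y) - (\<Sum>X\<in>S. int (snd X)) \<in> {0..int (card S) - 1})" (is "?L \<longleftrightarrow> ?R")
    if "refines {1..n} (fst ` \<alpha>) (fst ` \<beta>)" "Y \<in> \<beta>" for Y
  proof
    assume ?L
    then show ?R
      using wpart_union_exists[OF that]
      by (auto simp only: Let_def dest!: spec[of _ "{X\<in>\<alpha>. fst X \<subseteq> fst Y}"])
  next
    assume ?R
    show ?L
    proof (intro allI impI)
      fix S assume S: "S \<subseteq> \<alpha>" "fst Y = (\<Union>X\<in>S. fst X)"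
      show "int (snd Y) - (\<Sum>X\<in>S. int (snd X)) \<in> {0..int (card S) - 1}"
        using \<open>?R\<close> wpart_union_unique[OF assms(1) S] by (simp only: Let_def)
    qed
  qed
  then show ?thesis using assms
    by (simp add: wpart_rel_def case_prod_beta del: atLeastAtMost_iff cong: conj_cong)
qed

lemma wpart_rel_refl:
  assumes "\<alpha> \<in> weighted_partitions n" shows "(\<alpha>, \<alpha>) \<in> wpart_rel n"
proof -
  have "{X\<in>\<alpha>. fst X \<subseteq> fst Y} = {Y}" if "Y \<in> \<alpha>" for Y
    using wpart_union_unique[OF assms, of "{Y}" "fst Y"] that by auto
  then show ?thesis
    using assms unfolding wpart_rel_iff[OF assms assms]
    by (auto simp: weighted_partitions_def intro: refines_refl)
qed

lemma wpart_rel_antisym: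
  assumes "(\<alpha>, \<beta>) \<in> wpart_rel n" "(\<beta>, \<alpha>) \<in> wpart_rel n"
  shows "\<alpha> = \<beta>"
proof -
  have le: "\<beta> \<subseteq> \<alpha>" if ab: "(\<alpha>, \<beta>) \<in> wpart_rel n" and ba: "(\<beta>, \<alpha>) \<in> wpart_rel n" for \<alpha> \<beta>
  proof
    fix Y assume Y: "Y \<in> \<beta>"
    have w: "\<alpha> \<in> weighted_partitions n" "\<beta> \<in> weighted_partitions n"
      using ab by (auto simp: wpart_rel_def)
    have "fst ` \<alpha> = fst ` \<beta>"
      using ab[unfolded wpart_rel_iff[OF w]] ba[unfolded wpart_rel_iff[OF w(2,1)]]
      by (elim conjE) (rule refines_asym)
    then obtain X where X: "X \<in> \<alpha>" "fst X = fst Y" using Y by (metis imageE imageI)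
    then have S: "{X\<in>\<alpha>. fst X \<subseteq> fst Y} = {X}"
      using wpart_union_unique[OF w(1), of "{X}" "fst X"] by auto
    have "int (snd Y) - int (snd X) \<in> {0..0}"
      using ab[unfolded wpart_rel_iff[OF w]] Y S by (auto simp: Let_def dest!: bspec)
    then have "X = Y" using X by (auto intro: prod_eqI)
    then show "Y \<in> \<alpha>" using X by simp
  qed
  show ?thesis using le[OF assms] le[OF assms(2,1)] by auto
qed

lemma wpart_rel_trans:
  assumes ab: "(\<alpha>, \<beta>) \<in> wpart_rel n" and bc: "(\<beta>, \<gamma>) \<in> wpart_rel n"
  shows "(\<alpha>, \<gamma>) \<in> wpart_rel n"
proof -
  have w: "\<alpha> \<in> weighted_partitions n" "\<beta> \<in> weighted_partitions n" "\<gamma> \<in> weighted_partitions n"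
    using ab bc by (auto simp: wpart_rel_def)
  note ab' = ab[unfolded wpart_rel_iff[OF w(1,2)] Let_def]
  note bc' = bc[unfolded wpart_rel_iff[OF w(2,3)] Let_def]
  define U where "U = (\<lambda>Y :: nat set \<times> nat. {X\<in>\<alpha>. fst X \<subseteq> fst Y})"
  have "int (snd Z) - (\<Sum>X\<in>U Z. int (snd X)) \<in> {0..int (card (U Z)) - 1}" if Z: "Z \<in> \<gamma>" for Z
  proof -
    define T where "T = {Y\<in>\<beta>. fst Y \<subseteq> fst Z}"
    have finT: "finite T" and finU: "finite (U Y)" for Y
      using w wpart_finite by (auto simp: T_def U_def)
    have "X \<in> (\<Union>Y\<in>T. U Y)" if X: "X \<in> U Z" for X
    proof -
      obtain Y where Y: "Y \<in> \<beta>" "fst X \<subseteq> fst Y"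
        using X ab' by (fastforce simp: refines_def U_def)
      obtain Z' where Z': "Z' \<in> \<gamma>" "fst Y \<subseteq> fst Z'"
        using Y bc' by (fastforce simp: refines_def)
      obtain i where "i \<in> fst X" using X wpart_nonempty[OF w(1), of X] by (auto simp: U_def)
      then have "Z' = Z"
        using wpart_disjoint[OF w(3) Z'(1) Z, of i] X Y Z' by (auto simp: U_def)
      then have "Y \<in> T" "X \<in> U Y" using X Y Z' by (simp_all add: T_def U_def)
      then show ?thesis by blast
    qed
    moreover have "X \<in> U Z" if "Y \<in> T" "X \<in> U Y" for X Y
      using that by (auto simp: T_def U_def)
    ultimately have U: "U Z = (\<Union>Y\<in>T. U Y)" by blast
    have disj: "\<forall>Y\<in>T. \<forall>Y'\<in>T. Y \<noteq> Y' \<longrightarrow> U Y \<inter> U Y' = {}"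
    proof (intro ballI impI, rule ccontr)
      fix Y Y' assume Y: "Y \<in> T" "Y' \<in> T" "Y \<noteq> Y'" "U Y \<inter> U Y' \<noteq> {}"
      then obtain X where X: "X \<in> U Y" "X \<in> U Y'" by auto
      then obtain i where "i \<in> fst X" using wpart_nonempty[OF w(1), of X] by (auto simp: U_def)
      then show False using wpart_disjoint[OF w(2), of Y Y' i] X Y by (auto simp: T_def U_def)
    qed
    have sum: "(\<Sum>X\<in>U Z. int (snd X)) = (\<Sum>Y\<in>T. \<Sum>X\<in>U Y. int (snd X))"
      unfolding U using finT finU disj by (intro sum.UNION_disjoint) auto
    have card: "int (card (U Z)) = (\<Sum>Y\<in>T. int (card (U Y)))"
      unfolding U using finT finU disj by (subst card_UN_disjoint) auto
    have Y: "0 \<le> int (snd Y) - (\<Sum>X\<in>U Y. int (snd X))"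
      "int (snd Y) - (\<Sum>X\<in>U Y. int (snd X)) \<le> int (card (U Y)) - 1" if "Y \<in> T" for Y
      using ab' that by (auto simp: T_def U_def)
    have "0 \<le> (\<Sum>Y\<in>T. int (snd Y) - (\<Sum>X\<in>U Y. int (snd X)))"
      "(\<Sum>Y\<in>T. int (snd Y) - (\<Sum>X\<in>U Y. int (snd X))) \<le> (\<Sum>Y\<in>T. int (card (U Y)) - 1)"
      using Y by (auto intro!: sum_nonneg sum_mono)
    moreover have "int (snd Z) - (\<Sum>Y\<in>T. int (snd Y)) \<in> {0..int (card T) - 1}"
      using bc' Z by (auto simp: T_def)
    ultimately show ?thesis unfolding sum card by (auto simp: sum_subtractf)
  qed
  moreover have "refines {1..n} (fst ` \<alpha>) (fst ` \<gamma>)"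
    using ab' bc' by (blast intro: refines_trans)
  ultimately show ?thesis unfolding wpart_rel_iff[OF w(1,3)] by (auto simp: U_def Let_def)
qed

lemma wpart_partial_order: "partial_order_on (weighted_partitions n) (wpart_rel n)"
  unfolding partial_order_on_def preorder_on_def
proof (intro conjI)
  show "wpart_rel n \<subseteq> weighted_partitions n \<times> weighted_partitions n"
    unfolding wpart_rel_def by blast
  show "refl_on (weighted_partitions n) (wpart_rel n)"
    by (rule refl_onI) (rule wpart_rel_refl)
  show "trans (wpart_rel n)" by (rule transI) (rule wpart_rel_trans)
  show "antisym (wpart_rel n)" by (rule antisymI) (rule wpart_rel_antisym)
qed

lemma Field_wpart_rel: "Field (wpart_rel n) = weighted_partitions n"
proof
  show "Field (wpart_rel n) \<subseteq> weighted_partitions n"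
    unfolding Field_def wpart_rel_def by blast
  show "weighted_partitions n \<subseteq> Field (wpart_rel n)"
    by (auto intro: FieldI1 wpart_rel_refl)
qed

lemma wpart_bot_least:
  assumes "\<alpha> \<in> weighted_partitions n" shows "(wpart_bot n, \<alpha>) \<in> wpart_rel n"
proof -
  have img: "fst ` wpart_bot n = (\<lambda>i. {i}) ` {1..n}"
    by (auto simp: wpart_bot_def image_image)
  have wb: "wpart_bot n \<in> weighted_partitions n"
    unfolding weighted_partitions_def
    using partition_on_singletons[of "{1..n}"] img by (auto simp: wpart_bot_def inj_on_def)
  have part: "partition_on {1..n} (fst ` \<alpha>)" and wt: "\<And>Y. Y \<in> \<alpha> \<Longrightarrow> snd Y \<le> card (fst Y) - 1"
    using assms by (auto simp: weighted_partitions_def)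
  have "refines {1..n} (fst ` wpart_bot n) (fst ` \<alpha>)"
    unfolding refines_def img
    using part partition_on_singletons[of "{1..n}"] wpart_cover[OF assms] by auto
  moreover have "int (snd Y) - (\<Sum>X\<in>S. int (snd X)) \<in> {0..int (card S) - 1}"
    if Y: "Y \<in> \<alpha>" and S: "S = {X\<in>wpart_bot n. fst X \<subseteq> fst Y}" for Y S
  proof -
    have sub: "fst Y \<subseteq> {1..n}" using wpart_cover[OF assms] Y by auto
    then have S': "S = (\<lambda>i. ({i}, 0)) ` fst Y" unfolding S wpart_bot_def by auto
    have "card S = card (fst Y)" unfolding S' by (rule card_image) (auto simp: inj_on_def)
    moreover have "(\<Sum>X\<in>S. int (snd X)) = 0" unfolding S' by (rule sum.neutral) auto
    moreover have "card (fst Y) > 0"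
      using wpart_nonempty[OF assms Y] sub finite_subset by (auto simp: card_gt_0_iff)
    ultimately show ?thesis using wt[OF Y] by auto
  qed
  ultimately show ?thesis unfolding wpart_rel_iff[OF wb assms] Let_def by blast
qed

lemma mobius_wpart:
  assumes "(\<alpha>, \<beta>) \<in> wpart_rel n"
  shows "mobius (wpart_rel n) \<alpha> \<beta> =
    (if \<alpha> = \<beta> then 1
     else - (\<Sum>\<gamma>\<in>poset_interval (wpart_rel n) \<alpha> \<beta> - {\<beta>}. mobius (wpart_rel n) \<alpha> \<gamma>))"
proof -
  have "poset_interval (wpart_rel n) \<alpha> \<beta> \<subseteq> weighted_partitions n"
    by (auto simp: poset_interval_def wpart_rel_def)
  then have "finite (poset_interval (wpart_rel n) \<alpha> \<beta>)"
    using finite_weighted_partitions finite_subset by blast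
  then show ?thesis
    using assms wpart_partial_order[of n]
    by (subst mobius.simps) (simp add: Field_wpart_rel)
qed

end

theory Submission
  imports Defs "HOL-Library.FuncSet"
begin

text \<open>
  Put \<open>h \<beta> = (x - |\<beta>|) ^ (|\<beta>| - 1)\<close>. If \<open>h\<close> sums to \<open>x ^ (|\<alpha>| - 1)\<close> over the elements above each
  \<open>\<alpha>\<close>, then by exchanging sums the characteristic polynomial is the sum of
  \<open>h \<beta> * (\<Sum>\<alpha> \<le> \<beta>. \<mu> \<alpha>)\<close> over \<open>\<beta>\<close>, in which only the least element survives, with \<open>(x - n) ^ (n - 1)\<close>.
  To sum \<open>h\<close> over an upper interval, note that the elements above \<open>\<alpha>\<close> correspond to the idempotent
  self-maps of the set of blocks of \<open>\<alpha>\<close>, the number of blocks being the size of the image. There are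
  \<open>(k choose l) * l ^ (k - l)\<close> such maps on \<open>k\<close> blocks with image of size \<open>l\<close>, and the claim becomes
  Abel's identity.
\<close>

section \<open>Abel's identity\<close>

text \<open>This is the vanishing of an n-th finite difference of a polynomial of degree below n.
  One factor y - i is split off: its y-part is the induction hypothesis for the same n, and in its
  i-part the factor i is absorbed into the binomial coefficient, which leaves the hypothesis for n -
  1 at y - 1. Hence the induction on m is over all n and y at once.\<close>

lemma alternating_sum_choose_power:
  fixes y :: "'a::comm_ring_1"
  assumes "m < n"
  shows "(\<Sum>i\<le>n. (-1) ^ i * of_nat (n choose i) * (y - of_nat i) ^ m) = 0"
  using assms
proof (induction m arbitrary: n y)
  case 0
  then show ?case by (simp add: choose_alternating_sum)
next
  case (Suc m)
  then obtain k where n: "n = Suc k" and "m < k" by (cases n) auto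
  have "(\<Sum>i\<le>n. (-1) ^ i * of_nat (n choose i) * of_nat i * (y - of_nat i) ^ m) =
    (\<Sum>i\<le>k. (-1) ^ Suc i * of_nat (Suc i * (Suc k choose Suc i)) * (y - of_nat (Suc i)) ^ m)"
    unfolding n by (subst sum.atMost_Suc_shift) (simp add: algebra_simps)
  also have "\<dots> = - of_nat (Suc k) *
      (\<Sum>i\<le>k. (-1) ^ i * of_nat (k choose i) * ((y - 1) - of_nat i) ^ m)"
    unfolding Suc_times_binomial sum_distrib_left
    by (intro sum.cong refl)
      (simp only: of_nat_mult of_nat_Suc power_Suc, simp add: mult_ac algebra_simps)
  also have "\<dots> = 0" using Suc.IH[OF \<open>m < k\<close>] by simp
  finally have "(\<Sum>i\<le>n. (-1) ^ i * of_nat (n choose i) * of_nat i * (y - of_nat i) ^ m) = 0" .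
  moreover have "(\<Sum>i\<le>n. (-1) ^ i * of_nat (n choose i) * (y - of_nat i) ^ Suc m) =
    y * (\<Sum>i\<le>n. (-1) ^ i * of_nat (n choose i) * (y - of_nat i) ^ m)
    - (\<Sum>i\<le>n. (-1) ^ i * of_nat (n choose i) * of_nat i * (y - of_nat i) ^ m)"
    by (simp add: sum_distrib_left sum_subtractf[symmetric] algebra_simps)
  ultimately show ?case using Suc.IH[of n y] Suc.prems by simp
qed

text \<open>
  Expanding \<open>l = y - (y - l)\<close> binomially in the power \<open>l ^ (k - l)\<close> turns the sum over \<open>l\<close> into
  finite differences of powers.
\<close>

lemma abel_identity:
  fixes y :: "'a::comm_ring_1"
  assumes "k \<ge> 1"
  shows "(\<Sum>l=1..k. of_nat (k choose l) * of_nat l ^ (k - l) * (y - of_nat l) ^ (l - 1)) = y ^ (k - 1)"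
proof -
  \<comment> \<open>\<open>c l m\<close> is the contribution of \<open>y ^ m\<close> to the term at
    l, regrouped so that l enters only as in a difference of order k - m. The powers of y - l have
    merged into one of exponent k - m - 1, just below that order.\<close>
  define c :: "nat \<Rightarrow> nat \<Rightarrow> 'a" where
    "c l m = of_nat (k choose m) * of_nat ((k - m) choose l) * y ^ m *
      (-1) ^ (k - m - l) * (y - of_nat l) ^ (k - m - 1)" for l m
  have expand: "of_nat (k choose l) * of_nat l ^ (k - l) * (y - of_nat l) ^ (l - 1) = (\<Sum>m\<le>k - l. c l m)"
    if l: "l \<in> {1..k}" for l
  proof -
    have "(of_nat l :: 'a) ^ (k - l) = (y + (-1) * (y - of_nat l)) ^ (k - l)" by simp
    also have "\<dots> = (\<Sum>m\<le>k - l. of_nat ((k - l) choose m) * y ^ m * ((-1) * (y - of_nat l)) ^ (k - l - m))"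
      by (rule binomial_ring)
    finally have *: "(of_nat l :: 'a) ^ (k - l) = \<dots>" .
    have "of_nat (k choose l) * (of_nat ((k - l) choose m) * y ^ m *
        ((-1) * (y - of_nat l)) ^ (k - l - m)) * (y - of_nat l) ^ (l - 1) = c l m"
      if m: "m \<in> {..k - l}" for m
    proof -
      \<comment> \<open>Both sides count the pairs of disjoint subsets of sizes l and m in a
        k-set.\<close>
      have "(k choose l) * ((k - l) choose m) = (k choose m) * ((k - m) choose l)"
        using l m choose_mult[of m "m + l" k] choose_mult[of l "m + l" k]
          binomial_symmetric[of m "m + l"] by auto
      then have ch: "of_nat (k choose l) * of_nat ((k - l) choose m) =
          (of_nat (k choose m) * of_nat ((k - m) choose l) :: 'a)"
        by (metis of_nat_mult)
      have "k - m - 1 = (k - l - m) + (l - 1)" "k - m - l = k - l - m" using l m by auto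
      then have p: "(y - of_nat l) ^ (k - m - 1) = (y - of_nat l) ^ (k - l - m) * (y - of_nat l) ^ (l - 1)"
        and q: "(-1 :: 'a) ^ (k - m - l) = (-1) ^ (k - l - m)"
        by (simp_all add: power_add)
      show ?thesis unfolding c_def p q ch[symmetric] power_mult_distrib by (simp only: mult_ac)
    qed
    then show ?thesis unfolding * sum_distrib_left sum_distrib_right by (intro sum.cong) auto
  qed
  \<comment> \<open>With l = 0 included, the sum is a vanishing finite difference; so the sum from 1
    is minus the term at 0, in which the power of y no longer depends on m.\<close>
  have collapse: "(\<Sum>l=1..k - m. c l m) = - (of_nat (k choose m) * (-1) ^ (k - m) * y ^ (k - 1))"
    if m: "m < k" for m
  proof -
    define N where "N = k - m"
    have "N > 0" using m by (simp add: N_def)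
    have sgn: "(-1 :: 'a) ^ (N - l) = (-1) ^ N * (-1) ^ l" if "l \<le> N" for l
      using that by (metis (no_types) le_add_diff_inverse2 minus_one_mult_self mult.assoc mult.right_neutral power_add)
    have "(\<Sum>l\<le>N. c l m) = of_nat (k choose m) * y ^ m * (-1) ^ N *
        (\<Sum>l\<le>N. (-1) ^ l * of_nat (N choose l) * (y - of_nat l) ^ (N - 1))"
      unfolding sum_distrib_left
      by (intro sum.cong refl) (simp add: c_def N_def[symmetric] sgn mult_ac)
    also have "\<dots> = 0" using alternating_sum_choose_power[of "N - 1" N y] \<open>N > 0\<close> by simp
    finally have "c 0 m + (\<Sum>l=1..N. c l m) = 0"
      by (simp add: atMost_atLeast0 sum.atLeast_Suc_atMost)
    moreover have "c 0 m = of_nat (k choose m) * (-1) ^ N * y ^ (k - 1)"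
    proof -
      have "k - 1 = m + (N - 1)" using m by (simp add: N_def)
      then show ?thesis by (simp add: c_def N_def[symmetric] power_add mult_ac)
    qed
    ultimately show ?thesis by (simp add: N_def eq_neg_iff_add_eq_0 add.commute)
  qed
  \<comment> \<open>This is the expansion of \<open>(1 - 1) ^ k\<close> without its last term; k
    must be positive for that power to be 0.\<close>
  have alt: "(\<Sum>m<k. of_nat (k choose m) * (-1) ^ (k - m)) = (-1 :: 'a)"
  proof -
    have "(\<Sum>m\<le>k. of_nat (k choose m) * 1 ^ m * (-1) ^ (k - m)) = (1 + (-1) :: 'a) ^ k"
      by (rule binomial_ring[symmetric])
    then have "(\<Sum>m<k. of_nat (k choose m) * (-1) ^ (k - m)) + 1 = (0 :: 'a)"
      using assms by (simp add: lessThan_Suc_atMost[symmetric] power_0_left)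
    then show ?thesis by (simp add: eq_neg_iff_add_eq_0)
  qed
  \<comment> \<open>Since l is at least 1, m = k never occurs. So m may be confined to m < k, where
    \<open>collapse\<close> applies.\<close>
  have "(\<Sum>l=1..k. of_nat (k choose l) * of_nat l ^ (k - l) * (y - of_nat l) ^ (l - 1)) =
      (\<Sum>l\<in>{1..k}. \<Sum>m\<in>{m \<in> {..<k}. m + l \<le> k}. c l m)"
  proof (rule sum.cong[OF refl])
    fix l assume l: "l \<in> {1..k}"
    then have "{..k - l} = {m \<in> {..<k}. m + l \<le> k}" by auto
    then show "of_nat (k choose l) * of_nat l ^ (k - l) * (y - of_nat l) ^ (l - 1) =
        (\<Sum>m\<in>{m \<in> {..<k}. m + l \<le> k}. c l m)"
      using expand[OF l] by simp
  qed
  also have "\<dots> = (\<Sum>m\<in>{..<k}. \<Sum>l\<in>{l \<in> {1..k}. m + l \<le> k}. c l m)"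
    by (rule sum.swap_restrict) auto
  also have "\<dots> = (\<Sum>m<k. \<Sum>l=1..k - m. c l m)"
    by (intro sum.cong refl) auto
  also have "\<dots> = (\<Sum>m<k. - (of_nat (k choose m) * (-1) ^ (k - m) * y ^ (k - 1)))"
    by (intro sum.cong refl collapse) simp
  also have "\<dots> = - (y ^ (k - 1) * (\<Sum>m<k. of_nat (k choose m) * (-1) ^ (k - m)))"
    by (simp add: sum_negf sum_distrib_left mult_ac)
  finally show ?thesis by (simp add: alt)
qed


section \<open>Idempotent maps\<close>

text \<open>Extensional functions are taken so that a map is determined by its values on A and can
  be counted.\<close>

definition idempotent_maps :: "'a set \<Rightarrow> ('a \<Rightarrow> 'a) set"
  where "idempotent_maps A = {g \<in> A \<rightarrow>\<^sub>E A. \<forall>a\<in>A. g (g a) = g a}"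

text \<open>An idempotent map fixes every point of its image, and the other points may go anywhere
  in the image. The choices are independent, so the maps form a product set.\<close>

lemma idempotent_maps_with_image:
  assumes "R \<subseteq> A"
  shows "{g \<in> idempotent_maps A. g ` A = R} = (\<Pi>\<^sub>E a\<in>A. if a \<in> R then {a} else R)"
proof (intro equalityI subsetI)
  fix g assume "g \<in> {g \<in> idempotent_maps A. g ` A = R}"
  then show "g \<in> (\<Pi>\<^sub>E a\<in>A. if a \<in> R then {a} else R)"
    by (auto simp: idempotent_maps_def PiE_iff)
next
  fix g assume g: "g \<in> (\<Pi>\<^sub>E a\<in>A. if a \<in> R then {a} else R)"
  then have fix_R: "g a = a" if "a \<in> R" for a
    using that assms by (auto simp: PiE_iff dest!: bspec[of _ _ a])
  have to_R: "g a \<in> R" if "a \<in> A" for a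
    using that g by (cases "a \<in> R") (auto simp: PiE_iff dest!: bspec[of _ _ a])
  have "g ` A = R" using fix_R to_R assms by force
  moreover have "g \<in> A \<rightarrow>\<^sub>E A" using g to_R assms by (auto simp: PiE_iff)
  ultimately show "g \<in> {g \<in> idempotent_maps A. g ` A = R}"
    using fix_R to_R by (auto simp: idempotent_maps_def)
qed

lemma card_idempotent_maps_with_image:
  assumes "finite A" "R \<subseteq> A"
  shows "card {g \<in> idempotent_maps A. g ` A = R} = card R ^ (card A - card R)"
proof -
  have "(\<Prod>a\<in>A. card (if a \<in> R then {a} else R)) =
      (\<Prod>a\<in>A - R. card (if a \<in> R then {a} else R)) * (\<Prod>a\<in>R. card (if a \<in> R then {a} else R))"
    using assms by (rule prod.subset_diff[OF _ _, rotated])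
  also have "\<dots> = card R ^ card (A - R)" by simp
  also have "card (A - R) = card A - card R"
    using assms by (simp add: card_Diff_subset finite_subset)
  finally show ?thesis
    unfolding idempotent_maps_with_image[OF assms(2)] using assms(1) by (simp add: card_PiE)
qed

lemma finite_idempotent_maps: "finite A \<Longrightarrow> finite (idempotent_maps A)"
  by (rule finite_subset[of _ "A \<rightarrow>\<^sub>E A"]) (auto simp: idempotent_maps_def intro: finite_PiE)

text \<open>The maps are grouped by their image, and the images by their size. The convention
  \<open>0 ^ 0 = 1\<close> accounts for the empty map when A is empty.\<close>

lemma sum_idempotent_maps:
  fixes h :: "nat \<Rightarrow> 'b::comm_semiring_1"
  assumes "finite A"
  shows "(\<Sum>g\<in>idempotent_maps A. h (card (g ` A))) =
    (\<Sum>l\<le>card A. of_nat (card A choose l) * of_nat l ^ (card A - l) * h l)"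
proof -
  have "(\<Sum>g\<in>idempotent_maps A. h (card (g ` A))) =
      (\<Sum>R\<in>Pow A. \<Sum>g\<in>{g \<in> idempotent_maps A. g ` A = R}. h (card (g ` A)))"
    using assms
    by (intro sum.group[symmetric]) (auto simp: finite_idempotent_maps, auto simp: idempotent_maps_def)
  also have "\<dots> = (\<Sum>R\<in>Pow A. of_nat (card R) ^ (card A - card R) * h (card R))"
    using assms by (intro sum.cong refl) (simp add: card_idempotent_maps_with_image)
  also have "\<dots> = (\<Sum>l\<le>card A. \<Sum>R\<in>{R \<in> Pow A. card R = l}. of_nat (card R) ^ (card A - card R) * h (card R))"
    using assms by (intro sum.group[symmetric]) (auto intro: card_mono)
  also have "\<dots> = (\<Sum>l\<le>card A. of_nat (card A choose l) * of_nat l ^ (card A - l) * h l)"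
    using assms by (intro sum.cong refl) (simp add: n_subsets mult.assoc)
  finally show ?thesis .
qed


section \<open>Upper intervals of weighted partitions\<close>

lemma wpart_card_Union:
  assumes "\<alpha> \<in> weighted_partitions n" "S \<subseteq> \<alpha>"
  shows "card (\<Union>X\<in>S. fst X) = (\<Sum>X\<in>S. card (fst X))"
proof (rule card_UN_disjoint)
  show "finite S" using assms wpart_finite finite_subset by blast
  show "\<forall>X\<in>S. finite (fst X)"
    using assms wpart_cover[OF assms(1)] by (metis UN_upper finite_atLeastAtMost finite_subset subsetD)
  show "\<forall>X\<in>S. \<forall>Y\<in>S. X \<noteq> Y \<longrightarrow> fst X \<inter> fst Y = {}"
    using assms wpart_disjoint[OF assms(1)] by (meson disjoint_iff subsetD)
qed

lemma wpart_block_finite: "\<alpha> \<in> weighted_partitions n \<Longrightarrow> X \<in> \<alpha> \<Longrightarrow> finite (fst X)"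
  by (metis UN_upper finite_atLeastAtMost finite_subset wpart_cover)

text \<open>In this form, free of truncated subtraction, the bound can be added up over several
  blocks.\<close>

lemma wpart_weight: "\<alpha> \<in> weighted_partitions n \<Longrightarrow> X \<in> \<alpha> \<Longrightarrow> snd X + 1 \<le> card (fst X)"
proof -
  assume *: "\<alpha> \<in> weighted_partitions n" "X \<in> \<alpha>"
  then have "card (fst X) > 0"
    using wpart_block_finite wpart_nonempty card_gt_0_iff by blast
  moreover have "snd X \<le> card (fst X) - 1" using * by (auto simp: weighted_partitions_def)
  ultimately show ?thesis by simp
qed

text \<open>That \<beta> is a weighted partition is a conclusion here: summing weight + 1 \<le> size
  over S bounds the weight of Y by its size. One witness S per block is enough, because a union of
  blocks of \<alpha> determines which blocks occur in it.\<close>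

lemma wpart_coarseningI:
  assumes \<alpha>: "\<alpha> \<in> weighted_partitions n"
    and inj: "inj_on fst \<beta>" and part: "partition_on {1..n} (fst ` \<beta>)"
    and fibre: "\<And>Y. Y \<in> \<beta> \<Longrightarrow> \<exists>S\<subseteq>\<alpha>. fst Y = (\<Union>X\<in>S. fst X) \<and>
      (\<Sum>X\<in>S. snd X) \<le> snd Y \<and> snd Y < (\<Sum>X\<in>S. snd X) + card S"
  shows "(\<alpha>, \<beta>) \<in> wpart_rel n"
proof -
  have "snd Y \<le> card (fst Y) - 1" if Y: "Y \<in> \<beta>" for Y
  proof -
    obtain S where S: "S \<subseteq> \<alpha>" "fst Y = (\<Union>X\<in>S. fst X)" "snd Y < (\<Sum>X\<in>S. snd X) + card S"
      using fibre[OF Y] by blast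
    have "(\<Sum>X\<in>S. snd X + 1) \<le> (\<Sum>X\<in>S. card (fst X))"
      using wpart_weight[OF \<alpha>] S(1) by (intro sum_mono) blast
    then have "(\<Sum>X\<in>S. snd X) + card S \<le> card (fst Y)"
      using wpart_card_Union[OF \<alpha> S(1)] S(2) by (simp add: sum_Suc)
    then show ?thesis using S(3) by simp
  qed
  then have \<beta>: "\<beta> \<in> weighted_partitions n"
    using inj part by (auto simp: weighted_partitions_def)
  have "refines {1..n} (fst ` \<alpha>) (fst ` \<beta>)"
    unfolding refines_def
  proof (intro conjI ballI part)
    show "partition_on {1..n} (fst ` \<alpha>)" using \<alpha> by (auto simp: weighted_partitions_def)
    fix A assume "A \<in> fst ` \<alpha>"
    then obtain X where X: "X \<in> \<alpha>" "A = fst X" by auto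
    obtain i where i: "i \<in> fst X" using wpart_nonempty[OF \<alpha> X(1)] by auto
    then obtain Y where Y: "Y \<in> \<beta>" "i \<in> fst Y"
      using wpart_cover[OF \<alpha>] wpart_cover[OF \<beta>] X(1) by blast
    obtain S where S: "S \<subseteq> \<alpha>" "fst Y = (\<Union>X\<in>S. fst X)" using fibre[OF Y(1)] by blast
    then obtain Z where Z: "Z \<in> S" "i \<in> fst Z" using Y(2) by auto
    then have "Z = X" using wpart_disjoint[OF \<alpha>] S(1) X(1) i by blast
    then show "\<exists>B\<in>fst ` \<beta>. A \<subseteq> B" using Z S X(2) Y(1) by blast
  qed
  moreover have "int (snd Y) - (\<Sum>X\<in>T. int (snd X)) \<in> {0..int (card T) - 1}"
    if Y: "Y \<in> \<beta>" and T: "T = {X\<in>\<alpha>. fst X \<subseteq> fst Y}" for Y T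
  proof -
    obtain S where S: "S \<subseteq> \<alpha>" "fst Y = (\<Union>X\<in>S. fst X)"
      "(\<Sum>X\<in>S. snd X) \<le> snd Y" "snd Y < (\<Sum>X\<in>S. snd X) + card S"
      using fibre[OF Y] by blast
    have "S = T" using wpart_union_unique[OF \<alpha> S(1,2)] T by simp
    moreover have "int (snd Y) < int ((\<Sum>X\<in>S. snd X) + card S)" "int (\<Sum>X\<in>S. snd X) \<le> int (snd Y)"
      using S(3,4) by (simp_all del: of_nat_sum of_nat_add)
    ultimately show ?thesis by simp
  qed
  ultimately show ?thesis unfolding wpart_rel_iff[OF \<alpha> \<beta>] Let_def by blast
qed

text \<open>This is the converse of the preceding criterion, again with inequalities between natural
  numbers.\<close>

lemma wpart_relD:
  assumes "(\<alpha>, \<beta>) \<in> wpart_rel n" "Y \<in> \<beta>"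
  defines "S \<equiv> {X\<in>\<alpha>. fst X \<subseteq> fst Y}"
  shows "(\<Union>X\<in>S. fst X) = fst Y" "(\<Sum>X\<in>S. snd X) \<le> snd Y" "snd Y < (\<Sum>X\<in>S. snd X) + card S"
proof -
  have w: "\<alpha> \<in> weighted_partitions n" "\<beta> \<in> weighted_partitions n"
    using assms(1) by (auto simp: wpart_rel_def)
  have r: "refines {1..n} (fst ` \<alpha>) (fst ` \<beta>)"
    and v: "int (snd Y) - (\<Sum>X\<in>S. int (snd X)) \<in> {0..int (card S) - 1}"
    using assms(1)[unfolded wpart_rel_iff[OF w] Let_def] assms(2) unfolding S_def by blast+
  show "(\<Union>X\<in>S. fst X) = fst Y" unfolding S_def by (rule wpart_union_exists[OF r assms(2)])
  have "int (\<Sum>X\<in>S. snd X) \<le> int (snd Y)" "int (snd Y) < int ((\<Sum>X\<in>S. snd X) + card S)"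
    using v by auto
  then show "(\<Sum>X\<in>S. snd X) \<le> snd Y" "snd Y < (\<Sum>X\<in>S. snd X) + card S"
    by (simp_all only: of_nat_le_iff of_nat_less_iff)
qed

text \<open>The numbering is arbitrary but depends on the set alone. Two maps that share a fibre
  therefore number it in the same way, so that the root can be read off from the number.\<close>

definition position :: "'a set \<Rightarrow> 'a \<Rightarrow> nat"
  where "position P = (SOME e. bij_betw e P {0..<card P})"

lemma bij_betw_position: "finite P \<Longrightarrow> bij_betw (position P) P {0..<card P}"
  unfolding position_def using ex_bij_betw_finite_nat by (rule someI_ex)

text \<open>
  An idempotent map merges the blocks in each of its fibres; the position of the fibre's root (the
  common image) encodes the excess of the new weight over the sum of the old ones.
\<close>

definition merged_block :: "(nat set \<times> nat) set \<Rightarrow> (nat set \<times> nat) \<Rightarrow> nat set \<times> nat"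
  where "merged_block S r = (\<Union>X\<in>S. fst X, (\<Sum>X\<in>S. snd X) + position S r)"

definition merge :: "(nat set \<times> nat) set \<Rightarrow> (nat set \<times> nat \<Rightarrow> nat set \<times> nat) \<Rightarrow> (nat set \<times> nat) set"
  where "merge \<alpha> g = (\<lambda>r. merged_block {X\<in>\<alpha>. g X = r} r) ` (g ` \<alpha>)"

text \<open>The nonempty fibres of g partition \<alpha>, and a position in a fibre of l blocks
  ranges over 0, ..., l - 1, exactly the excess that the order permits. Blocks merged from different
  fibres are disjoint and nonempty, so none of them coincide.\<close>

lemma
  assumes \<alpha>: "\<alpha> \<in> weighted_partitions n" and g: "g \<in> idempotent_maps \<alpha>"
  shows merge_above: "(\<alpha>, merge \<alpha> g) \<in> wpart_rel n"
    and card_merge: "card (merge \<alpha> g) = card (g ` \<alpha>)"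
proof -
  define F where "F r = {X\<in>\<alpha>. g X = r}" for r
  define b where "b r = merged_block (F r) r" for r
  have merge: "merge \<alpha> g = b ` (g ` \<alpha>)" by (simp add: merge_def b_def F_def)
  have F: "F r \<subseteq> \<alpha>" "finite (F r)" for r using wpart_finite[OF \<alpha>] by (auto simp: F_def)
  have fst_b: "fst (b r) = (\<Union>X\<in>F r. fst X)" for r by (simp add: b_def merged_block_def)
  \<comment> \<open>Idempotence enters here: a point of the image is fixed, hence lies in its own
    fibre and has a position there.\<close>
  have root: "r \<in> F r" if "r \<in> g ` \<alpha>" for r
    using that g by (auto simp: idempotent_maps_def F_def)
  have disj: "fst (b r) \<inter> fst (b r') = {}" if "r \<noteq> r'" for r r'
  proof (rule ccontr)
    assume "fst (b r) \<inter> fst (b r') \<noteq> {}"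
    then obtain i X Y where "X \<in> F r" "Y \<in> F r'" "i \<in> fst X" "i \<in> fst Y" by (auto simp: fst_b)
    then show False using wpart_disjoint[OF \<alpha>, of X Y i] that by (auto simp: F_def)
  qed
  have nonempty: "fst (b r) \<noteq> {}" if "r \<in> g ` \<alpha>" for r
    using root[OF that] wpart_nonempty[OF \<alpha>, of r] F(1)[of r] by (auto simp: fst_b)
  have inj: "inj_on (\<lambda>r. fst (b r)) (g ` \<alpha>)"
  proof (rule inj_onI, rule ccontr)
    fix r r' assume "r \<in> g ` \<alpha>" "fst (b r) = fst (b r')" "r \<noteq> r'"
    then show False using disj[of r r'] nonempty[of r] by auto
  qed
  show "card (merge \<alpha> g) = card (g ` \<alpha>)"
    unfolding merge by (rule card_image, rule inj_on_imageI2[of fst]) (use inj in \<open>simp add: comp_def\<close>)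
  show "(\<alpha>, merge \<alpha> g) \<in> wpart_rel n"
  proof (rule wpart_coarseningI[OF \<alpha>])
    show "inj_on fst (merge \<alpha> g)"
      unfolding merge by (rule inj_on_imageI) (use inj in \<open>simp add: comp_def\<close>)
    show "partition_on {1..n} (fst ` merge \<alpha> g)"
    proof (rule partition_onI)
      have "\<Union>(fst ` merge \<alpha> g) = (\<Union>r\<in>g ` \<alpha>. \<Union>X\<in>F r. fst X)"
        unfolding merge by (simp add: fst_b image_image)
      also have "\<dots> = (\<Union>X\<in>\<alpha>. fst X)"
        unfolding F_def by blast
      finally have "\<Union>(fst ` merge \<alpha> g) = (\<Union>X\<in>\<alpha>. fst X)" .
      then show "\<Union>(fst ` merge \<alpha> g) = {1..n}" using wpart_cover[OF \<alpha>] by simp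
      show "\<And>p q. p \<in> fst ` merge \<alpha> g \<Longrightarrow> q \<in> fst ` merge \<alpha> g \<Longrightarrow> p \<noteq> q \<Longrightarrow> disjnt p q"
        unfolding merge disjnt_def
      proof (elim imageE)
        fix p q Y Z r r' assume "p \<noteq> q" "p = fst Y" "Y = b r" "q = fst Z" "Z = b r'"
        then show "p \<inter> q = {}" using disj[of r r'] by auto
      qed
      show "{} \<notin> fst ` merge \<alpha> g"
      proof
        assume "{} \<in> fst ` merge \<alpha> g"
        then show False unfolding merge
        proof (elim imageE)
          fix Y r X assume "{} = fst Y" "Y = b r" "r = g X" "X \<in> \<alpha>"
          then show False using nonempty[of r] by auto
        qed
      qed
    qed
    fix Y assume "Y \<in> merge \<alpha> g"
    then obtain r where r: "r \<in> g ` \<alpha>" "Y = b r" by (auto simp: merge)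
    have "position (F r) r < card (F r)"
      using bij_betw_apply[OF bij_betw_position[OF F(2)] root[OF r(1)]] by simp
    then show "\<exists>S\<subseteq>\<alpha>. fst Y = (\<Union>X\<in>S. fst X) \<and>
      (\<Sum>X\<in>S. snd X) \<le> snd Y \<and> snd Y < (\<Sum>X\<in>S. snd X) + card S"
      using r(2) F(1)[of r] by (intro exI[of _ "F r"]) (simp add: b_def merged_block_def)
  qed
qed

text \<open>A merged block gives back its fibre, since its underlying set is the union of a unique
  set of blocks. Its weight then gives the position of the root, and positions within a fibre are
  distinct.\<close>

lemma inj_on_merge:
  assumes \<alpha>: "\<alpha> \<in> weighted_partitions n"
  shows "inj_on (merge \<alpha>) (idempotent_maps \<alpha>)"
proof (rule inj_onI)
  fix g g' assume g: "g \<in> idempotent_maps \<alpha>" and g': "g' \<in> idempotent_maps \<alpha>"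
    and eq: "merge \<alpha> g = merge \<alpha> g'"
  have "g a = g' a" if a: "a \<in> \<alpha>" for a
  proof -
    define S where "S = {X\<in>\<alpha>. g X = g a}"
    have "merged_block S (g a) \<in> merge \<alpha> g'"
      unfolding eq[symmetric] using a by (auto simp: merge_def S_def)
    then obtain r where r: "r \<in> g' ` \<alpha>" and
      b: "merged_block S (g a) = merged_block {X\<in>\<alpha>. g' X = r} r"
      unfolding merge_def by blast
    define S' where "S' = {X\<in>\<alpha>. g' X = r}"
    have S: "S = S'"
      using wpart_union_unique[OF \<alpha>, of S] wpart_union_unique[OF \<alpha>, of S' "\<Union>X\<in>S'. fst X"] b
      by (auto simp: merged_block_def S_def S'_def)
    have "g a \<in> S" "r \<in> S'" using g g' a r by (auto simp: idempotent_maps_def S_def S'_def)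
    moreover have "inj_on (position S) S"
      using wpart_finite[OF \<alpha>] by (intro bij_betw_imp_inj_on[OF bij_betw_position]) (simp add: S_def)
    ultimately have "g a = r"
      using b by (auto simp: merged_block_def S S'_def[symmetric] dest: inj_onD)
    moreover have "a \<in> S'" using a S by (auto simp: S_def)
    ultimately show ?thesis by (simp add: S'_def)
  qed
  then show "g = g'"
    using g g' by (auto simp: idempotent_maps_def intro: PiE_ext)
qed

text \<open>The map sends a block X of \<alpha> to the block \<open>t X\<close> of \<beta> that
  contains it, and from there to a root \<rho> inside \<open>t X\<close> whose position is the
  excess weight. It is idempotent because t undoes \<rho>.\<close>

lemma merge_surj:
  assumes rel: "(\<alpha>, \<beta>) \<in> wpart_rel n"
  shows "\<exists>g\<in>idempotent_maps \<alpha>. merge \<alpha> g = \<beta>"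
proof -
  have w: "\<alpha> \<in> weighted_partitions n" "\<beta> \<in> weighted_partitions n"
    using rel by (auto simp: wpart_rel_def)
  define S :: "nat set \<times> nat \<Rightarrow> (nat set \<times> nat) set" where "S Y = {X\<in>\<alpha>. fst X \<subseteq> fst Y}" for Y
  have finS: "finite (S Y)" for Y using wpart_finite[OF w(1)] by (simp add: S_def)
  note D = wpart_relD[OF rel, folded S_def]
  have "\<exists>Y\<in>\<beta>. X \<in> S Y" if "X \<in> \<alpha>" for X
    using that rel[unfolded wpart_rel_iff[OF w]] by (fastforce simp: refines_def S_def)
  then obtain t where t: "\<And>X. X \<in> \<alpha> \<Longrightarrow> t X \<in> \<beta> \<and> X \<in> S (t X)" by metis
  have t_eq: "t X = Y" if X: "X \<in> S Y" and Y: "Y \<in> \<beta>" for X Y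
  proof -
    have "X \<in> \<alpha>" using X by (simp add: S_def)
    obtain i where "i \<in> fst X" using wpart_nonempty[OF w(1) \<open>X \<in> \<alpha>\<close>] by auto
    then show ?thesis
      using wpart_disjoint[OF w(2) _ Y, of "t X" i] t[OF \<open>X \<in> \<alpha>\<close>] X by (auto simp: S_def)
  qed
  \<comment> \<open>The order relation keeps the excess below the number of merged blocks, so it is
    the position of some block. The subtraction is not truncated, by \<open>D(2)\<close>.\<close>
  have "\<exists>r\<in>S Y. position (S Y) r = snd Y - (\<Sum>X\<in>S Y. snd X)" if "Y \<in> \<beta>" for Y
  proof -
    have "snd Y - (\<Sum>X\<in>S Y. snd X) \<in> {0..<card (S Y)}" using D(2,3)[OF that] by auto
    then show ?thesis using bij_betw_imp_surj_on[OF bij_betw_position[OF finS[of Y]]] by (metis imageE)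
  qed
  then obtain \<rho> where \<rho>: "\<And>Y. Y \<in> \<beta> \<Longrightarrow>
      \<rho> Y \<in> S Y \<and> position (S Y) (\<rho> Y) = snd Y - (\<Sum>X\<in>S Y. snd X)"
    by metis
  define g where "g = restrict (\<lambda>X. \<rho> (t X)) \<alpha>"
  have sub: "S Y \<subseteq> \<alpha>" for Y by (auto simp: S_def)
  have t\<rho>: "t (\<rho> Y) = Y" if "Y \<in> \<beta>" for Y using that \<rho> t_eq by blast
  have g_eq: "g X = \<rho> (t X)" if "X \<in> \<alpha>" for X using that by (simp add: g_def)
  have "\<rho> Y \<in> \<alpha>" if "Y \<in> \<beta>" for Y using that \<rho> sub by blast
  then have "g \<in> idempotent_maps \<alpha>"
    using t t\<rho> by (auto simp: idempotent_maps_def g_def)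
  moreover have img: "g ` \<alpha> = \<rho> ` \<beta>"
  proof
    show "g ` \<alpha> \<subseteq> \<rho> ` \<beta>" using g_eq t by auto
    show "\<rho> ` \<beta> \<subseteq> g ` \<alpha>"
    proof
      fix r assume "r \<in> \<rho> ` \<beta>"
      then obtain Y where Y: "Y \<in> \<beta>" "r = \<rho> Y" by auto
      then have "\<rho> Y \<in> \<alpha>" using \<rho> sub by blast
      then show "r \<in> g ` \<alpha>" using g_eq[of "\<rho> Y"] t\<rho>[OF Y(1)] Y(2) by (metis imageI)
    qed
  qed
  have "merged_block {X\<in>\<alpha>. g X = \<rho> Y} (\<rho> Y) = Y" if Y: "Y \<in> \<beta>" for Y
  proof -
    have "{X\<in>\<alpha>. g X = \<rho> Y} = S Y"
    proof (intro equalityI subsetI)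
      fix X assume "X \<in> {X\<in>\<alpha>. g X = \<rho> Y}"
      then have X: "X \<in> \<alpha>" "\<rho> (t X) = \<rho> Y" using g_eq[of X] by simp_all
      then have "t X = Y" using t\<rho> t Y by metis
      then show "X \<in> S Y" using t[OF X(1)] by simp
    next
      fix X assume X: "X \<in> S Y"
      then have "X \<in> \<alpha>" using sub by blast
      then show "X \<in> {X\<in>\<alpha>. g X = \<rho> Y}" using g_eq t_eq[OF X Y] by simp
    qed
    then show ?thesis
      using D(1,2)[OF Y] \<rho>[OF Y] by (intro prod_eqI) (simp_all add: merged_block_def)
  qed
  then have "merge \<alpha> g = \<beta>"
    unfolding merge_def img image_image by (simp cong: image_cong)
  ultimately show ?thesis by blast
qed

lemma bij_betw_merge:
  assumes "\<alpha> \<in> weighted_partitions n"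
  shows "bij_betw (merge \<alpha>) (idempotent_maps \<alpha>) {\<beta>. (\<alpha>, \<beta>) \<in> wpart_rel n}"
proof (rule bij_betw_imageI[OF inj_on_merge[OF assms]])
  show "merge \<alpha> ` idempotent_maps \<alpha> = {\<beta>. (\<alpha>, \<beta>) \<in> wpart_rel n}"
    using merge_above[OF assms] merge_surj by blast
qed

text \<open>The number of blocks is the size of the image of an idempotent map. If no block is lost,
  the map is the identity; every fibre is then a single block with its root at position 0, and
  merging changes nothing. Thus going up strictly lowers the number of blocks, which controls the
  length of chains.\<close>

lemma wpart_rel_card:
  assumes "(\<alpha>, \<beta>) \<in> wpart_rel n"
  shows "card \<beta> \<le> card \<alpha>" and "card \<beta> = card \<alpha> \<Longrightarrow> \<beta> = \<alpha>"
proof -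
  have \<alpha>: "\<alpha> \<in> weighted_partitions n" using assms by (auto simp: wpart_rel_def)
  have fin: "finite \<alpha>" by (rule wpart_finite[OF \<alpha>])
  obtain g where g: "g \<in> idempotent_maps \<alpha>" and \<beta>: "\<beta> = merge \<alpha> g"
    using merge_surj[OF assms] by blast
  have card: "card \<beta> = card (g ` \<alpha>)" unfolding \<beta> by (rule card_merge[OF \<alpha> g])
  then show "card \<beta> \<le> card \<alpha>" using card_image_le[OF fin] by simp
  assume "card \<beta> = card \<alpha>"
  moreover have "g ` \<alpha> \<subseteq> \<alpha>" using g by (auto simp: idempotent_maps_def)
  ultimately have img: "g ` \<alpha> = \<alpha>" using card fin card_subset_eq by metis
  have id: "g X = X" if "X \<in> \<alpha>" for X
  proof -
    from that obtain Y where "Y \<in> \<alpha>" "X = g Y" using img by blast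
    then show ?thesis using g by (simp add: idempotent_maps_def)
  qed
  have "merged_block {X\<in>\<alpha>. g X = Y} Y = Y" if Y: "Y \<in> \<alpha>" for Y
  proof -
    have "{X\<in>\<alpha>. g X = Y} = {Y}" using id Y by auto
    moreover have "position {Y} Y = 0"
      using bij_betw_apply[OF bij_betw_position[of "{Y}"]] by simp
    ultimately show ?thesis by (simp add: merged_block_def)
  qed
  then show "\<beta> = \<alpha>" unfolding \<beta> merge_def img by (simp cong: image_cong)
qed

text \<open>The value y ranges over any commutative ring because the polynomial variable is
  substituted for it later.\<close>

lemma sum_wpart_above:
  fixes y :: "'a::comm_ring_1"
  assumes \<alpha>: "\<alpha> \<in> weighted_partitions n" and "\<alpha> \<noteq> {}"
  shows "(\<Sum>\<beta> | (\<alpha>, \<beta>) \<in> wpart_rel n. (y - of_nat (card \<beta>)) ^ (card \<beta> - 1)) = y ^ (card \<alpha> - 1)"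
proof -
  define h :: "nat \<Rightarrow> 'a" where "h l = (y - of_nat l) ^ (l - 1)" for l
  define k where "k = card \<alpha>"
  have fin: "finite \<alpha>" by (rule wpart_finite[OF \<alpha>])
  have "k \<ge> 1" using fin assms(2) by (simp add: k_def Suc_le_eq card_gt_0_iff)
  have "(\<Sum>\<beta> | (\<alpha>, \<beta>) \<in> wpart_rel n. h (card \<beta>)) = (\<Sum>g\<in>idempotent_maps \<alpha>. h (card (merge \<alpha> g)))"
    by (rule sum.reindex_bij_betw[OF bij_betw_merge[OF \<alpha>], symmetric])
  also have "\<dots> = (\<Sum>g\<in>idempotent_maps \<alpha>. h (card (g ` \<alpha>)))"
    by (intro sum.cong refl) (simp add: card_merge[OF \<alpha>])
  also have "\<dots> = (\<Sum>l\<le>k. of_nat (k choose l) * of_nat l ^ (k - l) * h l)"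
    unfolding k_def by (rule sum_idempotent_maps[OF fin])
  \<comment> \<open>The term at l = 0 contains \<open>0 ^ k\<close>, which vanishes as \<alpha> is
    nonempty.\<close>
  also have "\<dots> = (\<Sum>l=1..k. of_nat (k choose l) * of_nat l ^ (k - l) * h l)"
    using \<open>k \<ge> 1\<close> by (simp add: atMost_atLeast0 sum.atLeast_Suc_atMost power_0_left)
  also have "\<dots> = y ^ (k - 1)"
    unfolding h_def by (rule abel_identity[OF \<open>k \<ge> 1\<close>])
  finally show ?thesis by (simp add: h_def k_def)
qed


section \<open>The rank function\<close>

lemma wpart_bot_in: "wpart_bot n \<in> weighted_partitions n"
proof -
  have "fst ` wpart_bot n = (\<lambda>i. {i}) ` {1..n}" by (auto simp: wpart_bot_def image_image)
  then show ?thesis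
    using partition_on_singletons[of "{1..n}"]
    by (auto simp: weighted_partitions_def wpart_bot_def inj_on_def)
qed

lemma card_wpart_bot: "card (wpart_bot n) = n"
  unfolding wpart_bot_def by (subst card_image) (auto simp: inj_on_def)

text \<open>Splitting one point off a block adds exactly one block. This can be repeated down to the
  least element, which yields chains of maximal length.\<close>

lemma wpart_exists_below:
  assumes \<alpha>: "\<alpha> \<in> weighted_partitions n" and less: "card \<alpha> < n"
  shows "\<exists>\<delta>. (\<delta>, \<alpha>) \<in> wpart_rel n \<and> card \<delta> = Suc (card \<alpha>)"
proof -
  have fin: "finite \<alpha>" by (rule wpart_finite[OF \<alpha>])
  \<comment> \<open>Otherwise the block sizes, which add up to n, would sum to at most the number of
    blocks.\<close>
  have "\<exists>X\<in>\<alpha>. card (fst X) \<ge> 2"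
  proof (rule ccontr)
    assume "\<not> ?thesis"
    then have "(\<Sum>X\<in>\<alpha>. card (fst X)) \<le> (\<Sum>X\<in>\<alpha>. 1)" by (intro sum_mono) force
    then show False using wpart_card_Union[OF \<alpha> order_refl] wpart_cover[OF \<alpha>] less by simp
  qed
  then obtain B v where Bv: "(B, v) \<in> \<alpha>" and B2: "card B \<ge> 2" by auto
  have "finite B" using wpart_block_finite[OF \<alpha> Bv] by simp
  obtain i where i: "i \<in> B" using B2 by fastforce
  have card_Bi: "card (B - {i}) = card B - 1" using i \<open>finite B\<close> by simp
  then have "card (B - {i}) \<noteq> 0" using B2 by linarith
  then have "B - {i} \<noteq> {}" by (metis card.empty)
  define \<gamma> where "\<gamma> = \<alpha> - {(B, v)}"
  have \<alpha>_eq: "\<alpha> = insert (B, v) \<gamma>" using Bv by (auto simp: \<gamma>_def)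
  \<comment> \<open>Truncated subtraction serves both cases: the two pieces have total weight v - 1
    if v is positive and 0 if v = 0, so the excess is 1 or 0, as allowed for a merger of two
    blocks.\<close>
  define \<delta> where "\<delta> = insert ({i}, 0) (insert (B - {i}, v - 1) \<gamma>)"
  have disj: "fst X \<inter> B = {}" if "X \<in> \<gamma>" for X
    using that wpart_disjoint[OF \<alpha> _ Bv, of X] by (fastforce simp: \<gamma>_def)
  have ne: "fst X \<noteq> {}" if "X \<in> \<gamma>" for X using that wpart_nonempty[OF \<alpha>, of X] by (auto simp: \<gamma>_def)
  have new: "fst X \<noteq> {i}" "fst X \<noteq> B - {i}" if "X \<in> \<gamma>" for X
    using disj[OF that] ne[OF that] i by auto
  have neq: "{i} \<noteq> B - {i}" by auto
  have inj\<gamma>: "inj_on fst \<gamma>"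
    using \<alpha> by (auto simp: weighted_partitions_def \<gamma>_def intro: inj_on_subset)
  have cover: "(\<Union>X\<in>\<gamma>. fst X) \<union> B = {1..n}" using wpart_cover[OF \<alpha>] \<alpha>_eq by auto
  have part: "partition_on {1..n} (fst ` \<delta>)"
  proof (rule partition_onI)
    show "\<Union>(fst ` \<delta>) = {1..n}" using cover i by (auto simp: \<delta>_def)
    show "{} \<notin> fst ` \<delta>" using ne \<open>B - {i} \<noteq> {}\<close> by (auto simp: \<delta>_def)
    have "disjnt (fst X) (fst Y)" if "X \<in> \<gamma>" "Y \<in> \<gamma>" "fst X \<noteq> fst Y" for X Y
      using that wpart_disjoint[OF \<alpha>, of X Y] by (auto simp: disjnt_def \<gamma>_def)
    moreover have "disjnt (fst X) {i}" "disjnt {i} (fst X)"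
      "disjnt (fst X) (B - {i})" "disjnt (B - {i}) (fst X)" if "X \<in> \<gamma>" for X
      using disj[OF that] i by (auto simp: disjnt_def)
    moreover have "disjnt {i} (B - {i})" "disjnt (B - {i}) {i}" by (auto simp: disjnt_def)
    ultimately have "disjnt (fst X) (fst Y)" if "X \<in> \<delta>" "Y \<in> \<delta>" "fst X \<noteq> fst Y" for X Y
      using that unfolding \<delta>_def
      by (elim insertE) (simp_all del: disjnt_insert1 disjnt_insert2)
    then show "\<And>p q. p \<in> fst ` \<delta> \<Longrightarrow> q \<in> fst ` \<delta> \<Longrightarrow> p \<noteq> q \<Longrightarrow> disjnt p q"
      by (elim imageE) blast
  qed
  have notin: "{i} \<notin> fst ` \<gamma>" "B - {i} \<notin> fst ` \<gamma>"
    using new by (metis imageE)+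
  then have inj: "inj_on fst \<delta>"
    unfolding \<delta>_def inj_on_insert using inj\<gamma> neq by auto
  have v: "v \<le> card B - 1" using wpart_weight[OF \<alpha> Bv] by simp
  have "snd X \<le> card (fst X) - 1" if "X \<in> \<delta>" for X
    using that unfolding \<delta>_def
  proof (elim insertE)
    assume "X \<in> \<gamma>"
    then show ?thesis using wpart_weight[OF \<alpha>, of X] by (simp add: \<gamma>_def)
  qed (use v card_Bi in simp_all)
  then have \<delta>: "\<delta> \<in> weighted_partitions n"
    using inj part by (auto simp: weighted_partitions_def)
  have "(\<delta>, \<alpha>) \<in> wpart_rel n"
  proof (rule wpart_coarseningI[OF \<delta>])
    show "inj_on fst \<alpha>" "partition_on {1..n} (fst ` \<alpha>)"
      using \<alpha> by (auto simp: weighted_partitions_def)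
    fix Y assume "Y \<in> \<alpha>"
    then consider "Y = (B, v)" | "Y \<in> \<gamma>" by (auto simp: \<alpha>_eq)
    then show "\<exists>S\<subseteq>\<delta>. fst Y = (\<Union>X\<in>S. fst X) \<and>
      (\<Sum>X\<in>S. snd X) \<le> snd Y \<and> snd Y < (\<Sum>X\<in>S. snd X) + card S"
    proof cases
      case 1
      then show ?thesis
        using i neq by (intro exI[of _ "{({i}, 0), (B - {i}, v - 1)}"]) (auto simp: \<delta>_def)
    next
      case 2
      then show ?thesis by (intro exI[of _ "{Y}"]) (auto simp: \<delta>_def)
    qed
  qed
  moreover have "card \<delta> = Suc (card \<alpha>)"
  proof -
    have "({i}, 0) \<notin> insert (B - {i}, v - 1) \<gamma>" "(B - {i}, v - 1) \<notin> \<gamma>"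
      using notin neq by (metis fst_conv image_eqI insertE)+
    moreover have "finite \<gamma>" "(B, v) \<notin> \<gamma>" using fin by (auto simp: \<gamma>_def)
    ultimately show ?thesis by (simp add: \<delta>_def \<alpha>_eq)
  qed
  ultimately show ?thesis by blast
qed

lemma wpart_chain_exists:
  assumes "\<alpha> \<in> weighted_partitions n"
  shows "\<exists>C\<in>Chains (wpart_rel n). C \<subseteq> poset_interval (wpart_rel n) (wpart_bot n) \<alpha> \<and>
    finite C \<and> card C = n - card \<alpha> + 1"
  using assms
proof (induction "n - card \<alpha>" arbitrary: \<alpha>)
  case 0
  then have "{\<alpha>} \<in> Chains (wpart_rel n)" "\<alpha> \<in> poset_interval (wpart_rel n) (wpart_bot n) \<alpha>"
    by (auto simp: Chains_def poset_interval_def wpart_rel_refl wpart_bot_least)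
  then show ?case using 0 by (intro bexI[of _ "{\<alpha>}"]) auto
next
  case (Suc d)
  then have "card \<alpha> < n" by simp
  then obtain \<delta> where \<delta>: "(\<delta>, \<alpha>) \<in> wpart_rel n" "card \<delta> = Suc (card \<alpha>)"
    using wpart_exists_below Suc.prems by blast
  then have "\<delta> \<in> weighted_partitions n" by (auto simp: wpart_rel_def)
  moreover have "d = n - card \<delta>" using Suc.hyps(2) \<delta>(2) by simp
  ultimately obtain C where C: "C \<in> Chains (wpart_rel n)"
    "C \<subseteq> poset_interval (wpart_rel n) (wpart_bot n) \<delta>" "finite C" "card C = n - card \<delta> + 1"
    using Suc.hyps(1) by blast
  have below: "(\<gamma>, \<alpha>) \<in> wpart_rel n" "card \<gamma> \<ge> card \<delta>" if "\<gamma> \<in> C" for \<gamma>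
    using that C(2) \<delta>(1) wpart_rel_trans wpart_rel_card(1) by (auto simp: poset_interval_def)
  \<comment> \<open>Every member of C has more blocks than \<alpha>, so adding \<alpha> on top
    lengthens the chain.\<close>
  then have "\<alpha> \<notin> C" using \<delta>(2) by force
  moreover have "insert \<alpha> C \<in> Chains (wpart_rel n)"
    using C(1) below(1) wpart_rel_refl[OF Suc.prems] by (auto simp: Chains_def)
  moreover have "insert \<alpha> C \<subseteq> poset_interval (wpart_rel n) (wpart_bot n) \<alpha>"
    using below(1) C(2) wpart_bot_least[OF Suc.prems] wpart_rel_refl[OF Suc.prems]
    by (auto simp: poset_interval_def)
  ultimately show ?case
    using C(3,4) \<delta>(2) \<open>card \<alpha> < n\<close> by (intro bexI[of _ "insert \<alpha> C"]) auto
qed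

text \<open>Comparable elements with equally many blocks coincide, so the block count is injective
  on a chain, and in the interval it takes values between \<open>card \<alpha>\<close> and
  n.\<close>

lemma wpart_chain_card_le:
  assumes C: "C \<in> Chains (wpart_rel n)" and sub: "C \<subseteq> poset_interval (wpart_rel n) (wpart_bot n) \<alpha>"
  shows "card C \<le> n - card \<alpha> + 1"
proof -
  have "inj_on card C"
  proof (rule inj_onI)
    fix \<beta> \<gamma> assume *: "\<beta> \<in> C" "\<gamma> \<in> C" "card \<beta> = card \<gamma>"
    then have "(\<beta>, \<gamma>) \<in> wpart_rel n \<or> (\<gamma>, \<beta>) \<in> wpart_rel n" using C by (simp add: Chains_def)
    then show "\<beta> = \<gamma>"
      using wpart_rel_card(2)[of \<beta> \<gamma>] wpart_rel_card(2)[of \<gamma> \<beta>] *(3) by auto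
  qed
  moreover have "card ` C \<subseteq> {card \<alpha>..n}"
  proof (rule image_subsetI)
    fix \<gamma> assume "\<gamma> \<in> C"
    then have "(wpart_bot n, \<gamma>) \<in> wpart_rel n" "(\<gamma>, \<alpha>) \<in> wpart_rel n"
      using sub by (auto simp: poset_interval_def)
    then show "card \<gamma> \<in> {card \<alpha>..n}" using wpart_rel_card(1) card_wpart_bot by force
  qed
  ultimately have "card C \<le> card {card \<alpha>..n}" by (intro card_inj_on_le) auto
  then show ?thesis by simp
qed

lemma poset_rank_wpart:
  assumes "\<alpha> \<in> weighted_partitions n"
  shows "poset_rank (wpart_rel n) (wpart_bot n) \<alpha> = n - card \<alpha>"
  unfolding poset_rank_def
proof (rule Max_eqI)
  let ?M = "{card C - 1 |C. C \<in> Chains (wpart_rel n) \<and> C \<noteq> {} \<and>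
    C \<subseteq> poset_interval (wpart_rel n) (wpart_bot n) \<alpha>}"
  show le: "m \<le> n - card \<alpha>" if "m \<in> ?M" for m
    using that wpart_chain_card_le[of _ n \<alpha>] by fastforce
  show "finite ?M" by (rule finite_subset[of _ "{..n - card \<alpha>}"]) (use le in blast)+
  obtain C where "C \<in> Chains (wpart_rel n)"
    "C \<subseteq> poset_interval (wpart_rel n) (wpart_bot n) \<alpha>" "card C = n - card \<alpha> + 1"
    using wpart_chain_exists[OF assms] by blast
  then show "n - card \<alpha> \<in> ?M" by (intro CollectI exI[of _ C]) auto
qed


section \<open>The characteristic polynomial\<close>

text \<open>The elements below \<beta> form the interval from the least element to \<beta>, over
  which the recursion for the Moebius function makes the sum vanish unless the interval is a single
  point.\<close>

lemma sum_mobius_wpart_below: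
  assumes "\<beta> \<in> weighted_partitions n"
  shows "(\<Sum>\<alpha> | (\<alpha>, \<beta>) \<in> wpart_rel n. mobius (wpart_rel n) (wpart_bot n) \<alpha>) =
    (if \<beta> = wpart_bot n then 1 else 0)"
proof -
  let ?I = "poset_interval (wpart_rel n) (wpart_bot n) \<beta>"
  have I: "{\<alpha>. (\<alpha>, \<beta>) \<in> wpart_rel n} = ?I"
  proof -
    have "\<alpha> \<in> weighted_partitions n" if "(\<alpha>, \<beta>) \<in> wpart_rel n" for \<alpha>
      using that by (auto simp: wpart_rel_def)
    then show ?thesis using wpart_bot_least by (auto simp: poset_interval_def)
  qed
  have fin: "finite ?I"
    by (rule finite_subset[OF _ finite_weighted_partitions[of n]])
      (auto simp: poset_interval_def wpart_rel_def)
  have "\<beta> \<in> ?I" using assms by (simp add: poset_interval_def wpart_bot_least wpart_rel_refl)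
  then have split: "(\<Sum>\<alpha>\<in>?I. mobius (wpart_rel n) (wpart_bot n) \<alpha>) =
      mobius (wpart_rel n) (wpart_bot n) \<beta> + (\<Sum>\<alpha>\<in>?I - {\<beta>}. mobius (wpart_rel n) (wpart_bot n) \<alpha>)"
    by (rule sum.remove[OF fin])
  show ?thesis
  proof (cases "\<beta> = wpart_bot n")
    case True
    then have "?I - {\<beta>} = {}"
      using wpart_rel_antisym by (fastforce simp: poset_interval_def)
    then show ?thesis
      using True split mobius_wpart[OF wpart_bot_least[OF assms]] unfolding I by (simp only: sum.empty) simp
  next
    case False
    then show ?thesis
      using split mobius_wpart[OF wpart_bot_least[OF assms]] unfolding I by simp
  qed
qed

theorem theorem2p8:
  fixes n :: nat
  assumes "n \<ge> 1"
  shows "wpart_charpoly n = [:- int n, 1:] ^ (n - 1)"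
proof -
  let ?W = "weighted_partitions n"
  define \<mu> where "\<mu> = mobius (wpart_rel n) (wpart_bot n)"
  define X where "X = monom (1 :: int) 1"
  \<comment> \<open>This is the claimed polynomial with the number of blocks of \<beta> in place of
    n.\<close>
  define h where "h \<beta> = (X - of_nat (card \<beta>)) ^ (card \<beta> - 1)" for \<beta> :: "(nat set \<times> nat) set"
  have below: "{\<alpha> \<in> ?W. (\<alpha>, \<beta>) \<in> wpart_rel n} = {\<alpha>. (\<alpha>, \<beta>) \<in> wpart_rel n}"
    and above: "{\<alpha> \<in> ?W. (\<beta>, \<alpha>) \<in> wpart_rel n} = {\<alpha>. (\<beta>, \<alpha>) \<in> wpart_rel n}" for \<beta>
    by (auto simp: wpart_rel_def)
  \<comment> \<open>The rank turns the exponent into \<open>card \<alpha> - 1\<close>; the bounds 1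
    \<le> \<open>card \<alpha>\<close> \<le> n keep the subtractions exact. The power of X is then
    spread over the elements above \<alpha>.\<close>
  have summand: "monom (\<mu> \<alpha>) (n - 1 - poset_rank (wpart_rel n) (wpart_bot n) \<alpha>) =
      (\<Sum>\<beta>\<in>{\<beta> \<in> ?W. (\<alpha>, \<beta>) \<in> wpart_rel n}. of_int (\<mu> \<alpha>) * h \<beta>)" if \<alpha>: "\<alpha> \<in> ?W" for \<alpha>
  proof -
    have "\<alpha> \<noteq> {}" using wpart_cover[OF \<alpha>] assms by auto
    then have "card \<alpha> \<ge> 1" using wpart_finite[OF \<alpha>] by (simp add: Suc_le_eq card_gt_0_iff)
    moreover have "card \<alpha> \<le> n" using wpart_rel_card(1)[OF wpart_bot_least[OF \<alpha>]] card_wpart_bot by simp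
    ultimately have "n - 1 - poset_rank (wpart_rel n) (wpart_bot n) \<alpha> = card \<alpha> - 1"
      using poset_rank_wpart[OF \<alpha>] by simp
    moreover have "monom (\<mu> \<alpha>) (card \<alpha> - 1) = of_int (\<mu> \<alpha>) * X ^ (card \<alpha> - 1)"
      by (simp add: X_def monom_power of_int_poly smult_monom)
    moreover have "X ^ (card \<alpha> - 1) = (\<Sum>\<beta>\<in>{\<beta> \<in> ?W. (\<alpha>, \<beta>) \<in> wpart_rel n}. h \<beta>)"
      using sum_wpart_above[OF \<alpha> \<open>\<alpha> \<noteq> {}\<close>, of X] by (simp add: h_def above)
    ultimately show ?thesis by (simp add: sum_distrib_left)
  qed
  have "wpart_charpoly n =
      (\<Sum>\<alpha>\<in>?W. \<Sum>\<beta>\<in>{\<beta> \<in> ?W. (\<alpha>, \<beta>) \<in> wpart_rel n}. of_int (\<mu> \<alpha>) * h \<beta>)"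
    unfolding wpart_charpoly_def \<mu>_def[symmetric] by (intro sum.cong refl summand)
  also have "\<dots> = (\<Sum>\<beta>\<in>?W. \<Sum>\<alpha>\<in>{\<alpha> \<in> ?W. (\<alpha>, \<beta>) \<in> wpart_rel n}. of_int (\<mu> \<alpha>) * h \<beta>)"
    by (rule sum.swap_restrict) (rule finite_weighted_partitions)+
  also have "\<dots> = (\<Sum>\<beta>\<in>?W. of_int (\<Sum>\<alpha> | (\<alpha>, \<beta>) \<in> wpart_rel n. \<mu> \<alpha>) * h \<beta>)"
    by (simp only: below of_int_sum sum_distrib_right)
  also have "\<dots> = (\<Sum>\<beta>\<in>?W. if \<beta> = wpart_bot n then h \<beta> else 0)"
    by (intro sum.cong refl) (simp add: \<mu>_def sum_mobius_wpart_below)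
  also have "\<dots> = h (wpart_bot n)"
    using finite_weighted_partitions wpart_bot_in by simp
  also have "\<dots> = [:- int n, 1:] ^ (n - 1)"
    by (simp add: h_def card_wpart_bot X_def monom_altdef of_nat_poly)
  finally show ?thesis .
qed

end
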